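(* On the region $\{(t,x^1,x^2,x^3)\}\subset\mathbb R^4$ consider the de Sitter metric $ds^2=-dt^2+e^{lt}\delta_{ij}dx^idx^j$ ($l\neq0$ constant, $i,j=1,2,3$) and the symmetric tensor $K$ with components $K_{ij}=e^{2lt}\delta_{ij}$, $K_{tt}=K_{ti}=0$. For a constant $c\ge0$ let $\phi(t)=e^{lt/2}(1+ce^{lt})^{-1/2}$ and $\psi(t)=e^{-lt/2}(1+ce^{lt})^{1/2}$, and define the vector fields $$\Upsilon_0=\phi(t)\,\partial_t,\qquad \Upsilon_i=\phi(t)\,x^i\,\partial_t-\tfrac{2}{l}\psi(t)\,\partial_i\quad(i=1,2,3).$$ Then $\mathcal L_{\Upsilon_0}g=2\Omega_0\,(g+cK)$ and $\mathcal L_{\Upsilon_i}g=2x^i\Omega_0\,(g+cK)$ with $\Omega_0=\tfrac{l}{2}e^{lt/2}(1+ce^{lt})^{-3/2}$. For $c=0$ these reduce to proper conformal Killing vectors of $g$. Consequently, for the geodesic Lagrangian $L=\frac{1}{2n}\left[-\dot t^2+e^{lt}\delta_{ij}\dot x^i\dot x^j\right]-\frac{m^2}{2}n$, along any solution of its Euler–Lagrange equations on which $\kappa:=K^{\mu\nu}p_\mu p_\nu=p_1^2+p_2^2+p_3^2\neq0$, the quantities $\Upsilon_0^\mu p_\mu$ and $\Upsilon_i^\mu p_\mu$ with $c=m^2/\kappa$ are constant.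
   Context: $n(\lambda)>0$ is the einbein, dots denote $d/d\lambda$, $p_\mu=\partial L/\partial\dot{\mathrm x}^\mu$, $K^{\mu\nu}$ is $K$ with indices raised by $g$ (so $K=\sum_i\partial_i\otimes\partial_i$ with indices lowered, a Killing tensor built from spatial translations). *)

theory Defs
  imports "HOL-Analysis.Analysis"
begin

text \<open>Coordinates: a point of R^4 is q :: nat \<Rightarrow> real, with q 0 = t and q i = x^i (i = 1,2,3);
  components with index \<ge> 4 are ignored. Tensor / vector fields are given by components.\<close>

definition pd :: "((nat \<Rightarrow> real) \<Rightarrow> real) \<Rightarrow> nat \<Rightarrow> (nat \<Rightarrow> real) \<Rightarrow> real" where
  "pd f mu q = deriv (\<lambda>s. f (q(mu := s))) (q mu)"

definition gmet :: "real \<Rightarrow> (nat \<Rightarrow> real) \<Rightarrow> nat \<Rightarrow> nat \<Rightarrow> real" where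
  "gmet l q mu nu = (if mu = nu then (if mu = 0 then -1 else exp (l * q 0)) else 0)"

definition ginv :: "real \<Rightarrow> (nat \<Rightarrow> real) \<Rightarrow> nat \<Rightarrow> nat \<Rightarrow> real" where
  "ginv l q mu nu = (if mu = nu then (if mu = 0 then -1 else exp (- l * q 0)) else 0)"

definition Kten :: "real \<Rightarrow> (nat \<Rightarrow> real) \<Rightarrow> nat \<Rightarrow> nat \<Rightarrow> real" where
  "Kten l q mu nu = (if mu = nu \<and> mu \<noteq> 0 then exp (2 * l * q 0) else 0)"

definition Kup :: "real \<Rightarrow> (nat \<Rightarrow> real) \<Rightarrow> nat \<Rightarrow> nat \<Rightarrow> real" where
  "Kup l q mu nu = (\<Sum>a<4. \<Sum>b<4. ginv l q mu a * ginv l q nu b * Kten l q a b)"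

definition lie :: "((nat \<Rightarrow> real) \<Rightarrow> nat \<Rightarrow> real) \<Rightarrow> ((nat \<Rightarrow> real) \<Rightarrow> nat \<Rightarrow> nat \<Rightarrow> real)
                  \<Rightarrow> (nat \<Rightarrow> real) \<Rightarrow> nat \<Rightarrow> nat \<Rightarrow> real" where
  "lie V T q mu nu = (\<Sum>r<4. V q r * pd (\<lambda>q'. T q' mu nu) r q
                           + T q r nu * pd (\<lambda>q'. V q' r) mu q
                           + T q mu r * pd (\<lambda>q'. V q' r) nu q)"

definition phi :: "real \<Rightarrow> real \<Rightarrow> real \<Rightarrow> real" where
  "phi l c t = exp (l * t / 2) * (1 + c * exp (l * t)) powr (-1/2)"

definition psi :: "real \<Rightarrow> real \<Rightarrow> real \<Rightarrow> real" where
  "psi l c t = exp (- l * t / 2) * (1 + c * exp (l * t)) powr (1/2)"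

definition Omega0 :: "real \<Rightarrow> real \<Rightarrow> real \<Rightarrow> real" where
  "Omega0 l c t = l / 2 * exp (l * t / 2) * (1 + c * exp (l * t)) powr (-3/2)"

definition Ups0 :: "real \<Rightarrow> real \<Rightarrow> (nat \<Rightarrow> real) \<Rightarrow> nat \<Rightarrow> real" where
  "Ups0 l c q r = (if r = 0 then phi l c (q 0) else 0)"

definition Upsi :: "real \<Rightarrow> real \<Rightarrow> nat \<Rightarrow> (nat \<Rightarrow> real) \<Rightarrow> nat \<Rightarrow> real" where
  "Upsi l c i q r = (if r = 0 then phi l c (q 0) * q i
                     else if r = i then - (2 / l) * psi l c (q 0) else 0)"

definition proper_ckv :: "real \<Rightarrow> ((nat \<Rightarrow> real) \<Rightarrow> nat \<Rightarrow> real) \<Rightarrow> bool" where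
  "proper_ckv l V \<longleftrightarrow> (\<exists>sigma. (\<forall>q mu nu. mu < 4 \<longrightarrow> nu < 4 \<longrightarrow>
        lie V (gmet l) q mu nu = 2 * sigma q * gmet l q mu nu)
      \<and> (\<exists>q q'. sigma q \<noteq> sigma q'))"

definition lag :: "real \<Rightarrow> real \<Rightarrow> real \<Rightarrow> (nat \<Rightarrow> real) \<Rightarrow> (nat \<Rightarrow> real) \<Rightarrow> real" where
  "lag l m n q v = 1 / (2 * n) * (- ((v 0)^2) + exp (l * q 0) * (\<Sum>i\<in>{1..3}. (v i)^2)) - m^2 / 2 * n"

definition mom :: "real \<Rightarrow> real \<Rightarrow> real \<Rightarrow> (nat \<Rightarrow> real) \<Rightarrow> (nat \<Rightarrow> real) \<Rightarrow> nat \<Rightarrow> real" where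
  "mom l m n q v mu = deriv (\<lambda>s. lag l m n q (v(mu := s))) (v mu)"

text \<open>(n, x) with velocity xd solves the Euler-Lagrange equations of L on the parameter set I:
  xd is the derivative of x, n > 0, d/dlambda (dL/dxdot^mu) = dL/dx^mu, and dL/dn = 0
  (L does not depend on ndot).\<close>
definition EL_solution :: "real \<Rightarrow> real \<Rightarrow> real set \<Rightarrow> (real \<Rightarrow> real) \<Rightarrow> (real \<Rightarrow> nat \<Rightarrow> real)
                            \<Rightarrow> (real \<Rightarrow> nat \<Rightarrow> real) \<Rightarrow> bool" where
  "EL_solution l m I n x xd \<longleftrightarrow> (\<forall>s\<in>I. n s > 0
     \<and> (\<forall>mu<4. ((\<lambda>u. x u mu) has_real_derivative xd s mu) (at s))
     \<and> (\<forall>mu<4. ((\<lambda>u. mom l m (n u) (x u) (xd u) mu) has_real_derivative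
                  pd (\<lambda>q. lag l m (n s) q (xd s)) mu (x s)) (at s))
     \<and> deriv (\<lambda>nn. lag l m nn (x s) (xd s)) (n s) = 0)"

definition contr :: "(nat \<Rightarrow> real) \<Rightarrow> (nat \<Rightarrow> real) \<Rightarrow> real" where
  "contr V p = (\<Sum>mu<4. V mu * p mu)"

definition kappa :: "real \<Rightarrow> (nat \<Rightarrow> real) \<Rightarrow> (nat \<Rightarrow> real) \<Rightarrow> real" where
  "kappa l q p = (\<Sum>mu<4. \<Sum>nu<4. Kup l q mu nu * p mu * p nu)"

end

theory Submission
  imports Defs
begin

text \<open>Write \<open>u(t) = exp (-l t) + c\<close>. Then \<open>phi = u powr (-1/2)\<close>, \<open>psi = u powr (1/2)\<close> and
  \<open>Omega0 = l/2 exp (-l t) u powr (-3/2)\<close>, so that \<open>phi' = Omega0\<close>, \<open>psi' = -l/2 exp (-l t) phi\<close>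
  and \<open>2 Omega0 u = l exp (-l t) phi\<close>. Given these three identities the Lie derivatives are
  checked component by component.

  Along a solution of the Euler-Lagrange equations the momenta satisfy Hamilton's equations:
  the spatial momenta \<open>p i\<close> are constant (hence so is \<open>kappa\<close>), \<open>p 0' = l/2 n exp (-l t) kappa\<close>,
  and the einbein equation is the mass shell \<open>p 0 ^ 2 = exp (-l t) kappa + m^2\<close>, which for
  \<open>c = m^2 / kappa\<close> says \<open>p 0 ^ 2 = kappa u\<close>. Hence the derivative of \<open>phi p 0\<close> is
  \<open>n kappa / 2 (l exp (-l t) phi - 2 Omega0 u) = 0\<close>, and in the derivative of
  \<open>x i phi p 0 - 2/l psi p i\<close> the contributions of \<open>x i'\<close> and of \<open>psi'\<close> cancel.\<close>

lemma exp_mult_exp_minus: "exp (l * t) * exp (- l * t) = (1::real)"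
  using exp_minus_inverse[of "l * t"] by simp

lemma exp_minus_mult_one_plus: "exp (- l * t) * (1 + c * exp (l * t)) = exp (- l * t) + (c::real)"
proof -
  have "exp (- l * t) * (1 + c * exp (l * t)) = exp (- l * t) + c * (exp (l * t) * exp (- l * t))"
    by (simp add: distrib_left mult_ac)
  then show ?thesis by (simp only: exp_mult_exp_minus mult_1_right)
qed

lemma phi_eq_powr: "phi l c t = (exp (- l * t) + c) powr (-1/2)"
proof -
  have "exp (l * t / 2) = exp (- l * t) powr (-1/2)" by (simp add: exp_powr_real)
  then show ?thesis
    unfolding phi_def by (simp only: powr_mult[symmetric] exp_minus_mult_one_plus)
qed

lemma psi_eq_powr: "psi l c t = (exp (- l * t) + c) powr (1/2)"
proof -
  have "exp (- l * t / 2) = exp (- l * t) powr (1/2)" by (simp add: exp_powr_real)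
  then show ?thesis
    unfolding psi_def by (simp only: powr_mult[symmetric] exp_minus_mult_one_plus)
qed

lemma Omega0_eq_powr: "Omega0 l c t = l / 2 * exp (- l * t) * (exp (- l * t) + c) powr (-3/2)"
proof -
  have "exp (l * t / 2) = exp (- l * t) * exp (- l * t) powr (-3/2)"
    by (simp add: exp_powr_real flip: exp_add)
  then show ?thesis
    unfolding Omega0_def by (simp only: mult.assoc powr_mult[symmetric] exp_minus_mult_one_plus)
qed

lemma has_real_derivative_exp_minus_add:
  "((\<lambda>t. exp (- l * t) + c) has_real_derivative - l * exp (- l * t)) (at t)"
  by (auto intro!: derivative_eq_intros)

lemma has_real_derivative_phi:
  assumes "c \<ge> 0" shows "(phi l c has_real_derivative Omega0 l c t) (at t)"
proof -
  have "exp (- l * t) + c > 0" using assms by (simp add: add_pos_nonneg)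
  from DERIV_fun_powr[OF has_real_derivative_exp_minus_add this, of "-1/2"]
  show ?thesis
    unfolding phi_eq_powr[abs_def] Omega0_eq_powr by (simp add: mult_ac)
qed

lemma has_real_derivative_psi:
  assumes "c \<ge> 0" shows "(psi l c has_real_derivative - l / 2 * exp (- l * t) * phi l c t) (at t)"
proof -
  have "exp (- l * t) + c > 0" using assms by (simp add: add_pos_nonneg)
  from DERIV_fun_powr[OF has_real_derivative_exp_minus_add this, of "1/2"]
  show ?thesis
    unfolding psi_eq_powr[abs_def] phi_eq_powr by (simp add: mult_ac)
qed

lemma Omega0_conformal_factor:
  assumes "c \<ge> 0" shows "2 * Omega0 l c t * (exp (- l * t) + c) = l * exp (- l * t) * phi l c t"
proof -
  define u where "u = exp (- l * t) + c"
  have "u > 0" using assms by (simp add: u_def add_pos_nonneg)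
  then have "u powr (-3/2) * u = u powr (-1/2)"
    using powr_add[of u "-3/2" 1] by simp
  moreover have "2 * (l / 2 * exp (- l * t) * u powr (-3/2)) * u
      = l * exp (- l * t) * (u powr (-3/2) * u)"
    by simp
  ultimately show ?thesis
    unfolding Omega0_eq_powr phi_eq_powr u_def[symmetric] by simp
qed

lemma Omega0_conformal_factor_spatial:
  assumes "c \<ge> 0"
  shows "phi l c t * (l * exp (l * t)) = 2 * (Omega0 l c t * (exp (l * t) + c * exp (2 * l * t)))"
proof -
  have inv: "exp (- l * t) * exp (l * t) = 1"
    using exp_mult_exp_minus[of l t] by (simp only: mult.commute)
  have "exp (l * t) + c * exp (2 * l * t) = (exp (- l * t) + c) * (exp (l * t) * exp (l * t))"
    using inv by (simp add: algebra_simps flip: exp_add)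
  then have "2 * Omega0 l c t * (exp (l * t) + c * exp (2 * l * t))
      = l * phi l c t * (exp (- l * t) * exp (l * t)) * exp (l * t)"
    using Omega0_conformal_factor[OF assms, of l t] by (simp only: ac_simps)
  then show ?thesis using inv by (simp add: ac_simps)
qed

lemma sum_lessThan_4: "(\<Sum>r<(4::nat). f r) = f 0 + f 1 + f 2 + (f 3 :: real)"
  by (simp add: eval_nat_numeral)

lemma sum_atLeastAtMost_1_3: "(\<Sum>i\<in>{1..3::nat}. f i) = f 1 + f 2 + (f 3 :: real)"
  by (simp add: eval_nat_numeral atLeastAtMostSuc_conv)

lemma less_4_cases: "(mu::nat) < 4 \<Longrightarrow> mu = 0 \<or> mu = 1 \<or> mu = 2 \<or> mu = 3"
  by arith

lemma pd_eqI: "((\<lambda>s. f (q(r := s))) has_real_derivative D) (at (q r)) \<Longrightarrow> pd f r q = D"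
  unfolding pd_def by (rule DERIV_imp_deriv)

lemma pd_eq_0_if_independent: "(\<And>s. f (q(r := s)) = f q) \<Longrightarrow> pd f r q = 0"
  by (rule pd_eqI) simp

lemma pd_const [simp]: "pd (\<lambda>q'. a) r q = 0"
  by (rule pd_eq_0_if_independent) (rule refl)

lemma pd_time_function:
  assumes "\<And>t. (h has_real_derivative h' t) (at t)"
  shows "pd (\<lambda>q'. h (q' 0)) r q = (if r = 0 then h' (q 0) else 0)"
  using assms by (auto intro: pd_eqI pd_eq_0_if_independent)

lemma pd_time_function_times_coord:
  assumes "\<And>t. (h has_real_derivative h' t) (at t)" and "i \<noteq> 0"
  shows "pd (\<lambda>q'. h (q' 0) * q' i) r q
           = (if r = 0 then h' (q 0) * q i else if r = i then h (q 0) else 0)"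
proof -
  consider "r = 0" | "r = i" | "r \<noteq> 0" "r \<noteq> i" by blast
  then show ?thesis
  proof cases
    case 1
    then show ?thesis using assms by (auto intro!: pd_eqI DERIV_cmult_right)
  next
    case 2
    then show ?thesis using assms by (auto intro!: pd_eqI derivative_eq_intros)
  qed (auto intro: pd_eq_0_if_independent)
qed

lemma pd_exp_time: "pd (\<lambda>q'. exp (l * q' 0)) r q = (if r = 0 then l * exp (l * q 0) else 0)"
  by (rule pd_time_function) (auto intro!: derivative_eq_intros)

lemma pd_gmet:
  "pd (\<lambda>q'. gmet l q' mu nu) r q = (if r = 0 \<and> mu = nu \<and> mu \<noteq> 0 then l * exp (l * q 0) else 0)"
proof -
  consider "mu = nu" "mu \<noteq> 0" | "mu = nu" "mu = 0" | "mu \<noteq> nu" by blast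
  then show ?thesis
    by cases (simp_all add: gmet_def pd_exp_time)
qed

lemma pd_Ups0:
  assumes "c \<ge> 0"
  shows "pd (\<lambda>q'. Ups0 l c q' r) mu q = (if r = 0 \<and> mu = 0 then Omega0 l c (q 0) else 0)"
  using pd_time_function[OF has_real_derivative_phi[OF assms]] by (cases "r = 0") (simp_all add: Ups0_def)

lemma pd_Upsi:
  assumes "c \<ge> 0" and "l \<noteq> 0" and "i \<noteq> 0"
  shows "pd (\<lambda>q'. Upsi l c i q' r) mu q =
    (if r = 0 then (if mu = 0 then Omega0 l c (q 0) * q i else if mu = i then phi l c (q 0) else 0)
     else if r = i then (if mu = 0 then exp (- l * q 0) * phi l c (q 0) else 0) else 0)"
proof -
  have "((\<lambda>t. - (2 / l) * psi l c t) has_real_derivative exp (- l * t) * phi l c t) (at t)" for t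
    using DERIV_cmult[OF has_real_derivative_psi[OF assms(1), of l t], of "- (2 / l)"] assms(2)
    by simp
  then have pd_psi: "pd (\<lambda>q'. - (2 / l) * psi l c (q' 0)) mu q
      = (if mu = 0 then exp (- l * q 0) * phi l c (q 0) else 0)"
    by (rule pd_time_function)
  consider "r = 0" | "r = i" | "r \<noteq> 0" "r \<noteq> i" by blast
  then show ?thesis
  proof cases
    case 1
    then show ?thesis
      using pd_time_function_times_coord[OF has_real_derivative_phi[OF assms(1)] assms(3)]
      by (simp add: Upsi_def)
  next
    case 2
    then show ?thesis using pd_psi assms(3) by (simp add: Upsi_def)
  next
    case 3
    then show ?thesis by (simp add: Upsi_def)
  qed
qed

text \<open>Below, the \<open>pd\<close> terms are rewritten before the vector fields are unfolded; the simplifier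
  would otherwise unfold the components under the binder first and \<open>pd_Upsi\<close> would no longer match.\<close>

lemma lie_Ups0:
  assumes "c \<ge> 0" and "mu < 4" and "nu < 4"
  shows "lie (Ups0 l c) (gmet l) q mu nu
           = 2 * Omega0 l c (q 0) * (gmet l q mu nu + c * Kten l q mu nu)"
  unfolding lie_def sum_lessThan_4 pd_Ups0[OF assms(1)] pd_gmet
  using less_4_cases[OF assms(2)] less_4_cases[OF assms(3)]
  by (elim disjE) (simp_all add: Ups0_def gmet_def Kten_def Omega0_conformal_factor_spatial[OF assms(1)])

lemma lie_Upsi:
  assumes "c \<ge> 0" and "l \<noteq> 0" and "i \<in> {1..3}" and "mu < 4" and "nu < 4"
  shows "lie (Upsi l c i) (gmet l) q mu nu
           = 2 * q i * Omega0 l c (q 0) * (gmet l q mu nu + c * Kten l q mu nu)"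
proof -
  have "i \<noteq> 0" and "i = 1 \<or> i = 2 \<or> i = 3" using assms(3) by auto
  then show ?thesis
    unfolding lie_def sum_lessThan_4 pd_Upsi[OF assms(1,2) \<open>i \<noteq> 0\<close>] pd_gmet
    using less_4_cases[OF assms(4)] less_4_cases[OF assms(5)]
    by (elim disjE) (simp_all add: Upsi_def gmet_def Kten_def exp_minus_inverse
        Omega0_conformal_factor_spatial[OF assms(1)])
qed

lemma Omega0_de_Sitter: "Omega0 l 0 t = l / 2 * exp (l * t / 2)"
  by (simp add: Omega0_def)

lemma proper_ckv_Ups0:
  assumes "l \<noteq> 0" shows "proper_ckv l (Ups0 l 0)"
  unfolding proper_ckv_def
proof (intro exI conjI allI impI)
  show "lie (Ups0 l 0) (gmet l) q mu nu = 2 * Omega0 l 0 (q 0) * gmet l q mu nu"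
    if "mu < 4" "nu < 4" for q mu nu
    using lie_Ups0[of 0 mu nu l q] that by simp
  show "Omega0 l 0 ((\<lambda>_. 0) 0) \<noteq> Omega0 l 0 ((\<lambda>_. 2 / l) 0)"
    using assms by (simp add: Omega0_de_Sitter)
qed

lemma proper_ckv_Upsi:
  assumes "l \<noteq> 0" and "i \<in> {1..3}" shows "proper_ckv l (Upsi l 0 i)"
  unfolding proper_ckv_def
proof (intro exI conjI allI impI)
  show "lie (Upsi l 0 i) (gmet l) q mu nu = 2 * (q i * Omega0 l 0 (q 0)) * gmet l q mu nu"
    if "mu < 4" "nu < 4" for q mu nu
    using lie_Upsi[of 0 l i mu nu q] assms that by simp
  show "(\<lambda>_. 0) i * Omega0 l 0 ((\<lambda>_. 0) 0) \<noteq> (\<lambda>_. 1) i * Omega0 l 0 ((\<lambda>_. 1) 0)"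
    using assms(1) by (simp add: Omega0_de_Sitter)
qed

lemma kappa_eq_sum_squares: "kappa l q p = (\<Sum>i\<in>{1..3}. (p i)^2)"
  unfolding kappa_def Kup_def sum_lessThan_4 sum_atLeastAtMost_1_3
  by (simp add: ginv_def Kten_def power2_eq_square flip: exp_add)

lemma mom_time:
  assumes "n \<noteq> 0" shows "mom l m n q v 0 = - v 0 / n"
  unfolding mom_def lag_def sum_atLeastAtMost_1_3 using assms
  by (intro DERIV_imp_deriv) (auto intro!: derivative_eq_intros simp: power2_eq_square)

lemma mom_space:
  assumes "n \<noteq> 0" and "i \<in> {1..3}" shows "mom l m n q v i = exp (l * q 0) * v i / n"
proof -
  have "i = 1 \<or> i = 2 \<or> i = 3" using assms(2) by auto
  then show ?thesis
    unfolding mom_def lag_def sum_atLeastAtMost_1_3 using assms(1)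
    by (elim disjE) (auto intro!: DERIV_imp_deriv derivative_eq_intros simp: power2_eq_square)
qed

lemma pd_lag_time:
  assumes "n \<noteq> 0"
  shows "pd (\<lambda>q. lag l m n q v) 0 q = l * exp (l * q 0) * (\<Sum>i\<in>{1..3}. (v i)^2) / (2 * n)"
  unfolding lag_def using assms by (intro pd_eqI) (auto intro!: derivative_eq_intros)

lemma pd_lag_space: "i \<noteq> 0 \<Longrightarrow> pd (\<lambda>q. lag l m n q v) i q = 0"
  by (rule pd_eq_0_if_independent) (simp add: lag_def)

lemma deriv_lag_einbein:
  assumes "n \<noteq> 0"
  shows "deriv (\<lambda>n'. lag l m n' q v) n
           = ((v 0)^2 - exp (l * q 0) * (\<Sum>i\<in>{1..3}. (v i)^2)) / (2 * n^2) - m^2 / 2"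
  unfolding lag_def using assms
  by (intro DERIV_imp_deriv) (auto intro!: derivative_eq_intros simp: field_simps power2_eq_square)

lemma EL_solution_hamilton_equations:
  assumes EL: "EL_solution l m I n x xd" and s: "s \<in> I"
  defines "p \<equiv> \<lambda>u. mom l m (n u) (x u) (xd u)"
  shows "n s > 0"
    and "((\<lambda>u. x u 0) has_real_derivative - n s * p s 0) (at s)"
    and "i \<in> {1..3} \<Longrightarrow> ((\<lambda>u. x u i) has_real_derivative n s * exp (- l * x s 0) * p s i) (at s)"
    and "i \<in> {1..3} \<Longrightarrow> ((\<lambda>u. p u i) has_real_derivative 0) (at s)"
    and "((\<lambda>u. p u 0) has_real_derivative l / 2 * n s * exp (- l * x s 0) * kappa l (x s) (p s)) (at s)"
    and "(p s 0)^2 = exp (- l * x s 0) * kappa l (x s) (p s) + m^2"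
proof -
  have n: "n s > 0"
    and dx: "\<And>mu. mu < 4 \<Longrightarrow> ((\<lambda>u. x u mu) has_real_derivative xd s mu) (at s)"
    and dp: "\<And>mu. mu < 4 \<Longrightarrow>
      ((\<lambda>u. p u mu) has_real_derivative pd (\<lambda>q. lag l m (n s) q (xd s)) mu (x s)) (at s)"
    and einbein: "deriv (\<lambda>n'. lag l m n' (x s) (xd s)) (n s) = 0"
    using EL s unfolding EL_solution_def p_def by auto
  define E where "E = exp (l * x s 0)"
  define S where "S = (\<Sum>i\<in>{1..3}. (xd s i)^2)"
  have n0: "n s \<noteq> 0" using n by simp
  have E_inv: "exp (- l * x s 0) * E = 1"
    unfolding E_def using exp_mult_exp_minus[of l "x s 0"] by (simp only: mult.commute)
  have p0: "p s 0 = - xd s 0 / n s" unfolding p_def using n0 by (rule mom_time)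
  have pi: "p s i = E * xd s i / n s" if "i \<in> {1..3}" for i
    unfolding p_def E_def using n0 that by (rule mom_space)
  have kappa: "kappa l (x s) (p s) = E^2 * S / (n s)^2"
    unfolding kappa_eq_sum_squares S_def sum_atLeastAtMost_1_3 using pi
    by (simp add: power_divide power_mult_distrib add_divide_distrib distrib_left)
  show "n s > 0" by (fact n)
  show "((\<lambda>u. x u 0) has_real_derivative - n s * p s 0) (at s)"
    using dx[of 0] n0 by (simp add: p0)
  show "((\<lambda>u. x u i) has_real_derivative n s * exp (- l * x s 0) * p s i) (at s)" if "i \<in> {1..3}"
  proof -
    have "n s * exp (- l * x s 0) * p s i = xd s i"
      using that n0 E_inv by (simp add: pi field_simps)
    then show ?thesis using dx[of i] that by simp
  qed
  show "((\<lambda>u. p u i) has_real_derivative 0) (at s)" if "i \<in> {1..3}"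
    using dp[of i] that pd_lag_space[of i] by simp
  show "((\<lambda>u. p u 0) has_real_derivative l / 2 * n s * exp (- l * x s 0) * kappa l (x s) (p s)) (at s)"
  proof -
    have "l / 2 * n s * exp (- l * x s 0) * kappa l (x s) (p s) = l * E * S / (2 * n s)"
      using n0 E_inv unfolding kappa by (simp add: field_simps power2_eq_square)
    then show ?thesis
      using dp[of 0] pd_lag_time[OF n0] unfolding E_def S_def by (simp add: mult.commute)
  qed
  show "(p s 0)^2 = exp (- l * x s 0) * kappa l (x s) (p s) + m^2"
  proof -
    have "(xd s 0)^2 - E * S = m^2 * (n s)^2"
      using einbein deriv_lag_einbein[OF n0] n0 unfolding E_def S_def by (simp add: field_simps)
    then show ?thesis
      using n0 E_inv unfolding p0 kappa by (simp add: field_simps power2_eq_square)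
  qed
qed

lemma DERIV_zero_imp_eq_on_interval:
  fixes f :: "real \<Rightarrow> real"
  assumes "is_interval I" and "\<And>u. u \<in> I \<Longrightarrow> (f has_real_derivative 0) (at u)"
    and "a \<in> I" and "b \<in> I"
  shows "f a = f b"
proof -
  obtain k where "\<forall>u\<in>I. f u = k"
    using has_field_derivative_zero_constant[OF is_interval_convex[OF assms(1)]
        has_field_derivative_at_within[OF assms(2)]] by blast
  then show ?thesis using assms(3,4) by simp
qed

lemma kappa_conserved:
  assumes "is_interval I" and "EL_solution l m I n x xd" and "a \<in> I" and "b \<in> I"
  defines "p \<equiv> \<lambda>u. mom l m (n u) (x u) (xd u)"
  shows "kappa l (x a) (p a) = kappa l (x b) (p b)"
proof -
  have p: "mom l m (n u) (x u) (xd u) = p u" for u by (simp add: p_def)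
  note hamilton = EL_solution_hamilton_equations[OF assms(2), unfolded p]
  have "p a i = p b i" if "i \<in> {1..3}" for i
    using DERIV_zero_imp_eq_on_interval[OF assms(1) hamilton(4) assms(3,4)] that by blast
  then show ?thesis unfolding kappa_eq_sum_squares by (intro sum.cong) auto
qed

lemma contr_Ups0: "contr (Ups0 l c q) p = phi l c (q 0) * p 0"
  by (simp add: contr_def sum_lessThan_4 Ups0_def)

lemma contr_Upsi:
  assumes "i \<in> {1..3}"
  shows "contr (Upsi l c i q) p = phi l c (q 0) * q i * p 0 - 2 / l * psi l c (q 0) * p i"
proof -
  have "i = 1 \<or> i = 2 \<or> i = 3" using assms by auto
  then show ?thesis by (auto simp: contr_def sum_lessThan_4 Upsi_def)
qed

lemma has_real_derivative_Ups0_charge: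
  assumes EL: "EL_solution l m I n x xd" and s: "s \<in> I" and c: "c \<ge> 0"
    and mass_shell: "c * kappa l (x s) (mom l m (n s) (x s) (xd s)) = m^2"
  defines "p \<equiv> \<lambda>u. mom l m (n u) (x u) (xd u)"
  shows "((\<lambda>u. phi l c (x u 0) * p u 0) has_real_derivative 0) (at s)"
proof -
  have p: "mom l m (n u) (x u) (xd u) = p u" for u by (simp add: p_def)
  note hamilton = EL_solution_hamilton_equations[OF EL s, unfolded p]
  define K where "K = kappa l (x s) (p s)"
  define e where "e = exp (- l * x s 0)"
  define \<Omega> where "\<Omega> = Omega0 l c (x s 0)"
  have D: "((\<lambda>u. phi l c (x u 0) * p u 0) has_real_derivative
      \<Omega> * (- n s * p s 0) * p s 0 + l / 2 * n s * e * K * phi l c (x s 0)) (at s)"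
    unfolding K_def e_def \<Omega>_def
    by (intro DERIV_mult DERIV_chain2[OF has_real_derivative_phi[OF c]] hamilton)
  have "(p s 0)^2 = K * (e + c)"
    using hamilton(6) mass_shell[unfolded p] unfolding K_def e_def by (simp add: algebra_simps)
  then have factor: "\<Omega> * (- n s * p s 0) * p s 0 + l / 2 * n s * e * K * phi l c (x s 0)
      = n s * K / 2 * (l * e * phi l c (x s 0) - 2 * \<Omega> * (e + c))"
    by (simp add: power2_eq_square algebra_simps)
  have conformal: "2 * \<Omega> * (e + c) = l * e * phi l c (x s 0)"
    unfolding e_def \<Omega>_def by (rule Omega0_conformal_factor[OF c])
  show ?thesis using D unfolding factor conformal by simp
qed

lemma Ups_charges_conserved:
  assumes l: "l \<noteq> 0" and I: "is_interval I" and EL: "EL_solution l m I n x xd" and c: "c \<ge> 0"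
    and mass_shell: "\<And>s. s \<in> I \<Longrightarrow> c * kappa l (x s) (mom l m (n s) (x s) (xd s)) = m^2"
    and a: "a \<in> I" and b: "b \<in> I"
  defines "p \<equiv> \<lambda>u. mom l m (n u) (x u) (xd u)"
  shows "contr (Ups0 l c (x a)) (p a) = contr (Ups0 l c (x b)) (p b)"
    and "i \<in> {1..3} \<Longrightarrow> contr (Upsi l c i (x a)) (p a) = contr (Upsi l c i (x b)) (p b)"
proof -
  have p: "mom l m (n u) (x u) (xd u) = p u" for u by (simp add: p_def)
  note hamilton = EL_solution_hamilton_equations[OF EL, unfolded p]
  define F0 where "F0 u = phi l c (x u 0) * p u 0" for u
  have dF0: "(F0 has_real_derivative 0) (at s)" if "s \<in> I" for s
    unfolding F0_def p_def
    using has_real_derivative_Ups0_charge[OF EL that c mass_shell[OF that]] .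
  show "contr (Ups0 l c (x a)) (p a) = contr (Ups0 l c (x b)) (p b)"
    using DERIV_zero_imp_eq_on_interval[OF I dF0 a b] by (simp add: contr_Ups0 F0_def)
  assume i: "i \<in> {1..3}"
  define Fi where "Fi u = F0 u * x u i - 2 / l * psi l c (x u 0) * p u i" for u
  have "(Fi has_real_derivative 0) (at s)" if s: "s \<in> I" for s
  proof -
    have "(Fi has_real_derivative
        0 * x s i + n s * exp (- l * x s 0) * p s i * F0 s
        - (2 / l * (- l / 2 * exp (- l * x s 0) * phi l c (x s 0) * (- n s * p s 0)) * p s i
           + 0 * (2 / l * psi l c (x s 0)))) (at s)"
      unfolding Fi_def
      by (intro DERIV_diff DERIV_mult DERIV_cmult dF0 s DERIV_chain2[OF has_real_derivative_psi[OF c]]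
          hamilton[OF s] i)
    then show ?thesis using l by (simp add: F0_def field_simps)
  qed
  from DERIV_zero_imp_eq_on_interval[OF I this a b]
  show "contr (Upsi l c i (x a)) (p a) = contr (Upsi l c i (x b)) (p b)"
    using i by (simp add: contr_Upsi Fi_def F0_def ac_simps)
qed

theorem mainTheorem5:
  fixes l m :: real
  assumes l: "l \<noteq> 0"
  shows
    "(\<forall>c \<ge> 0. \<forall>q mu nu. mu < 4 \<longrightarrow> nu < 4 \<longrightarrow>
        lie (Ups0 l c) (gmet l) q mu nu
          = 2 * Omega0 l c (q 0) * (gmet l q mu nu + c * Kten l q mu nu)
      \<and> (\<forall>i\<in>{1..3}. lie (Upsi l c i) (gmet l) q mu nu
          = 2 * q i * Omega0 l c (q 0) * (gmet l q mu nu + c * Kten l q mu nu)))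
   \<and> proper_ckv l (Ups0 l 0) \<and> (\<forall>i\<in>{1..3}. proper_ckv l (Upsi l 0 i))
   \<and> (\<forall>I n x xd. open I \<longrightarrow> is_interval I \<longrightarrow> EL_solution l m I n x xd \<longrightarrow>
        (\<forall>s\<in>I. kappa l (x s) (mom l m (n s) (x s) (xd s)) \<noteq> 0) \<longrightarrow>
        (\<forall>s\<in>I. kappa l (x s) (mom l m (n s) (x s) (xd s))
                 = (\<Sum>i\<in>{1..3}. (mom l m (n s) (x s) (xd s) i)^2)) \<and>
        (\<forall>s0\<in>I. let c = m^2 / kappa l (x s0) (mom l m (n s0) (x s0) (xd s0)) in
          \<forall>a\<in>I. \<forall>b\<in>I.
            contr (Ups0 l c (x a)) (mom l m (n a) (x a) (xd a))
              = contr (Ups0 l c (x b)) (mom l m (n b) (x b) (xd b))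
          \<and> (\<forall>i\<in>{1..3}. contr (Upsi l c i (x a)) (mom l m (n a) (x a) (xd a))
              = contr (Upsi l c i (x b)) (mom l m (n b) (x b) (xd b)))))"
proof (intro conjI allI impI ballI)
  fix I n x xd s0
  assume I: "is_interval I" and EL: "EL_solution l m I n x xd" and s0: "s0 \<in> I"
    and nonzero: "\<forall>s\<in>I. kappa l (x s) (mom l m (n s) (x s) (xd s)) \<noteq> 0"
  define c where "c = m^2 / kappa l (x s0) (mom l m (n s0) (x s0) (xd s0))"
  have "kappa l (x s0) (mom l m (n s0) (x s0) (xd s0)) \<ge> 0"
    unfolding kappa_eq_sum_squares by (simp add: sum_nonneg)
  then have c: "c \<ge> 0" unfolding c_def by simp
  have "c * kappa l (x s) (mom l m (n s) (x s) (xd s)) = m^2" if "s \<in> I" for s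
    using kappa_conserved[OF I EL that s0] nonzero s0 unfolding c_def by simp
  from Ups_charges_conserved[OF l I EL c this]
  show "let c = m^2 / kappa l (x s0) (mom l m (n s0) (x s0) (xd s0)) in
          \<forall>a\<in>I. \<forall>b\<in>I.
            contr (Ups0 l c (x a)) (mom l m (n a) (x a) (xd a))
              = contr (Ups0 l c (x b)) (mom l m (n b) (x b) (xd b))
          \<and> (\<forall>i\<in>{1..3}. contr (Upsi l c i (x a)) (mom l m (n a) (x a) (xd a))
              = contr (Upsi l c i (x b)) (mom l m (n b) (x b) (xd b)))"
    unfolding Let_def c_def[symmetric] by blast
qed (simp_all add: lie_Ups0 lie_Upsi l proper_ckv_Ups0 proper_ckv_Upsi kappa_eq_sum_squares)
end
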